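(* Let $(E,T,S,e)$ be a conditional expectation preserving system. The following statements are equivalent: (i) the system $(E,T,S,e)$ is ergodic; (ii) for any component $p$ of $e$, $T((e-p)\,Sp)=0$ implies that $p\in R(T)$; (iii) for any component $p$ of $e$, $\bigvee_{n=1}^{\infty}S^{n}p\in R(T)$.
   Context: A conditional Riesz triple $(E,e,T)$ consists of a Dedekind complete Riesz space $E$, a weak order unit $e$ of $E$, and a conditional expectation operator $T$ on $E$, that is, a strictly positive order continuous linear projection $T:E\to E$ with $Te=e$ and Dedekind complete range $R(T)$. A conditional expectation preserving system is a 4-tuple $(E,T,S,e)$ where $(E,e,T)$ is a conditional Riesz triple and $S:E\to E$ is an order continuous Riesz (lattice) homomorphism with $Se=e$ and $TSf=Tf$ for all $f\in E$. The system is called ergodic if, for every $f\in E$, $Sf=f$ implies $Tf=f$. A component of $e$ is an element $p\in E$ with $p\wedge(e-p)=0$. Products are taken in the $f$-algebra structure for which $e$ is the multiplicative unit; for components $p,q$ of $e$ one has $pq=p\wedge q$. *)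

theory Defs
  imports Complex_Main "HOL-Library.Lattice_Algebras"
begin

section \<open>Conditional expectation preserving systems\<close>

text \<open>The conditional completeness axioms say that every nonempty subset that is bounded above
  (below) has a supremum (infimum), which is Dedekind completeness. The type is the whole space.\<close>

class dedekind_complete_riesz_space =
  ordered_real_vector + lattice_ab_group_add_abs + conditionally_complete_lattice

text \<open>The condition \<open>e > 0\<close> is relaxed to \<open>e \<ge> 0\<close>, which makes a difference only
  in the zero space.\<close>

definition weak_order_unit :: "'a::dedekind_complete_riesz_space \<Rightarrow> bool" where
  "weak_order_unit e \<longleftrightarrow> 0 \<le> e \<and> (\<forall>f. inf \<bar>f\<bar> e = 0 \<longrightarrow> f = 0)"

definition component :: "'a::dedekind_complete_riesz_space \<Rightarrow> 'a \<Rightarrow> bool" where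
  "component e p \<longleftrightarrow> inf p (e - p) = 0"

definition strictly_positive :: "('a::dedekind_complete_riesz_space \<Rightarrow> 'a) \<Rightarrow> bool" where
  "strictly_positive T \<longleftrightarrow> (\<forall>f. 0 < f \<longrightarrow> 0 < T f)"

definition directed_down :: "'a::dedekind_complete_riesz_space set \<Rightarrow> bool" where
  "directed_down A \<longleftrightarrow> A \<noteq> {} \<and> (\<forall>x\<in>A. \<forall>y\<in>A. \<exists>z\<in>A. z \<le> x \<and> z \<le> y)"

text \<open>Order continuity of a positive operator \<open>L\<close>: if \<open>A\<close> is directed downwards with infimum
  \<open>0\<close>, then so is its image. The operators below are positive, so no absolute values are needed.
  The explicit boundedness is required for \<open>Inf\<close> to be meaningful.\<close>

definition order_continuous :: "('a::dedekind_complete_riesz_space \<Rightarrow> 'a) \<Rightarrow> bool" where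
  "order_continuous L \<longleftrightarrow>
     (\<forall>A. directed_down A \<and> bdd_below A \<and> Inf A = 0 \<longrightarrow> bdd_below (L ` A) \<and> Inf (L ` A) = 0)"

text \<open>Dedekind completeness of a subset in the induced order: bounds and suprema are taken
  inside \<open>R\<close>.\<close>

definition dedekind_complete_in :: "'a::dedekind_complete_riesz_space set \<Rightarrow> bool" where
  "dedekind_complete_in R \<longleftrightarrow>
     (\<forall>A\<subseteq>R. A \<noteq> {} \<and> (\<exists>b\<in>R. \<forall>a\<in>A. a \<le> b) \<longrightarrow>
        (\<exists>s\<in>R. (\<forall>a\<in>A. a \<le> s) \<and> (\<forall>b\<in>R. (\<forall>a\<in>A. a \<le> b) \<longrightarrow> s \<le> b)))"

definition conditional_expectation ::
    "'a::dedekind_complete_riesz_space \<Rightarrow> ('a \<Rightarrow> 'a) \<Rightarrow> bool" where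
  "conditional_expectation e T \<longleftrightarrow>
     linear T \<and> strictly_positive T \<and> order_continuous T \<and> (\<forall>f. T (T f) = T f) \<and>
     T e = e \<and> dedekind_complete_in (range T)"

definition conditional_riesz_triple ::
    "'a::dedekind_complete_riesz_space \<Rightarrow> ('a \<Rightarrow> 'a) \<Rightarrow> bool" where
  "conditional_riesz_triple e T \<longleftrightarrow> weak_order_unit e \<and> conditional_expectation e T"

definition riesz_homomorphism :: "('a::dedekind_complete_riesz_space \<Rightarrow> 'a) \<Rightarrow> bool" where
  "riesz_homomorphism S \<longleftrightarrow>
     linear S \<and> (\<forall>f g. S (sup f g) = sup (S f) (S g)) \<and> (\<forall>f g. S (inf f g) = inf (S f) (S g))"

definition cond_exp_preserving_system ::
    "('a::dedekind_complete_riesz_space \<Rightarrow> 'a) \<Rightarrow> ('a \<Rightarrow> 'a) \<Rightarrow> 'a \<Rightarrow> bool" where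
  "cond_exp_preserving_system T S e \<longleftrightarrow>
     conditional_riesz_triple e T \<and> riesz_homomorphism S \<and> order_continuous S \<and>
     S e = e \<and> (\<forall>f. T (S f) = T f)"

definition ergodic ::
    "('a::dedekind_complete_riesz_space \<Rightarrow> 'a) \<Rightarrow> ('a \<Rightarrow> 'a) \<Rightarrow> bool" where
  "ergodic T S \<longleftrightarrow> (\<forall>f. S f = f \<longrightarrow> T f = f)"


section \<open>The f-algebra product with unit \<open>e\<close>\<close>

definition principal_ideal :: "'a::dedekind_complete_riesz_space \<Rightarrow> 'a set" where
  "principal_ideal e = {f. \<exists>r::real. \<bar>f\<bar> \<le> r *\<^sub>R e}"

text \<open>In general only the ideal generated by \<open>e\<close>, and not the whole space, carries an f-algebra
  product with unit \<open>e\<close>. The ideal contains all components of \<open>e\<close>; values of \<open>m\<close> outside it are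
  irrelevant.\<close>

definition f_algebra_product ::
    "'a::dedekind_complete_riesz_space \<Rightarrow> ('a \<Rightarrow> 'a \<Rightarrow> 'a) \<Rightarrow> bool" where
  "f_algebra_product e m \<longleftrightarrow> (let I = principal_ideal e in
     (\<forall>f\<in>I. \<forall>g\<in>I. m f g \<in> I) \<and>
     (\<forall>f\<in>I. \<forall>g\<in>I. \<forall>h\<in>I. m (m f g) h = m f (m g h)) \<and>
     (\<forall>f\<in>I. \<forall>g\<in>I. \<forall>h\<in>I. m (f + g) h = m f h + m g h \<and> m h (f + g) = m h f + m h g) \<and>
     (\<forall>c. \<forall>f\<in>I. \<forall>g\<in>I. m (c *\<^sub>R f) g = c *\<^sub>R m f g \<and> m f (c *\<^sub>R g) = c *\<^sub>R m f g) \<and>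
     (\<forall>f\<in>I. \<forall>g\<in>I. 0 \<le> f \<and> 0 \<le> g \<longrightarrow> 0 \<le> m f g) \<and>
     (\<forall>f\<in>I. \<forall>g\<in>I. \<forall>h\<in>I. inf f g = 0 \<and> 0 \<le> h \<longrightarrow>
        inf (m h f) g = 0 \<and> inf (m f h) g = 0) \<and>
     (\<forall>f\<in>I. m e f = f \<and> m f e = f))"


subsection \<open>Existence\<close>

lemma riesz_archimedean:
  fixes y z :: "'a::dedekind_complete_riesz_space"
  assumes "\<And>n::nat. real n *\<^sub>R z \<le> y"
  shows "z \<le> 0"
proof -
  let ?s = "SUP n::nat. real n *\<^sub>R z"
  have bdd: "bdd_above (range (\<lambda>n::nat. real n *\<^sub>R z))"
    using assms by (auto simp: bdd_above_def)
  have "real n *\<^sub>R z \<le> ?s - z" for n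
  proof -
    have "real (Suc n) *\<^sub>R z \<le> ?s" by (rule cSUP_upper[OF _ bdd]) simp
    moreover have "real (Suc n) *\<^sub>R z = real n *\<^sub>R z + z" by (simp add: scaleR_left_distrib)
    ultimately show ?thesis by (simp add: le_diff_eq)
  qed
  then have "?s \<le> ?s - z" by (intro cSUP_least) auto
  then show ?thesis by (simp add: le_diff_eq)
qed

lemma riesz_inf_sup_le:
  fixes a b c :: "'a::dedekind_complete_riesz_space"
  shows "inf (sup a b) c \<le> sup (inf a c) (inf b c)"
proof -
  let ?w = "sup (inf a c) (inf b c)" and ?s = "sup (sup a b) c"
  have "a + c = sup a c + inf a c" "b + c = sup b c + inf b c"
    by (rule add_eq_inf_sup)+
  moreover have "sup a c \<le> ?s" "sup b c \<le> ?s"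
    by (meson le_sup_iff order_refl sup.coboundedI1 sup.cobounded1 sup.cobounded2)+
  moreover have "inf a c \<le> ?w" "inf b c \<le> ?w" by auto
  ultimately have "a + c \<le> ?s + ?w" "b + c \<le> ?s + ?w"
    by (metis add_mono)+
  then have "a \<le> ?s + ?w - c" "b \<le> ?s + ?w - c" by (auto simp: le_diff_eq)
  then have "sup a b + c \<le> ?s + ?w" by (simp add: le_diff_eq[symmetric])
  then have "?s + inf (sup a b) c \<le> ?s + ?w"
    using add_eq_inf_sup[of "sup a b" c] by simp
  then show ?thesis by simp
qed

lemma riesz_inf_le_mean:
  fixes x y :: "'a::dedekind_complete_riesz_space"
  shows "inf x y \<le> (1/2) *\<^sub>R (x + y)"
proof -
  have "inf x y + inf x y \<le> x + y" by (intro add_mono) auto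
  then have "(1/2) *\<^sub>R (inf x y + inf x y) \<le> (1/2) *\<^sub>R (x + y)"
    by (intro scaleR_left_mono) auto
  then show ?thesis by (simp add: scaleR_half_double)
qed

lemma abs_diff_grid:
  fixes e f z :: "'a::dedekind_complete_riesz_space"
  assumes e: "0 \<le> e" and f: "\<bar>f\<bar> \<le> r *\<^sub>R e" and z: "\<And>t::real. z \<le> \<bar>f - t *\<^sub>R e\<bar>"
    and d: "0 < d"
  shows "z \<le> d *\<^sub>R e"
proof -
  define s where "s k = - r + real k * d" for k
  have split: "\<bar>f - t *\<^sub>R e\<bar> = sup (f - t *\<^sub>R e) (t *\<^sub>R e - f)" for t
    by (simp add: abs_lattice)
  have *: "z \<le> sup (d *\<^sub>R e) (f - s k *\<^sub>R e)" for k
  proof (induction k)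
    case 0
    have "- f \<le> r *\<^sub>R e" using f by (meson abs_ge_minus_self order_trans)
    then have "0 \<le> f - s 0 *\<^sub>R e" by (simp add: s_def neg_le_iff_le le_diff_eq minus_le_iff)
        (metis add.commute add_le_cancel_left add.right_inverse)
    then have "\<bar>f - s 0 *\<^sub>R e\<bar> = f - s 0 *\<^sub>R e" by simp
    then show ?case using z[of "s 0"] by (metis le_supI2)
  next
    case (Suc k)
    let ?a = "f - s k *\<^sub>R e" and ?b = "f - s (Suc k) *\<^sub>R e" and ?w = "sup (d *\<^sub>R e) (f - s (Suc k) *\<^sub>R e)"
    have "z \<le> inf (sup (d *\<^sub>R e) ?a) (sup ?b (- ?b))"
      using Suc z[of "s (Suc k)"] by (simp add: abs_lattice)
    also have "\<dots> \<le> sup (inf (d *\<^sub>R e) (sup ?b (- ?b))) (inf ?a (sup ?b (- ?b)))"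
      by (rule riesz_inf_sup_le)
    also have "\<dots> \<le> sup (d *\<^sub>R e) (inf (sup ?b (- ?b)) ?a)"
      by (metis inf.cobounded1 inf.commute order_refl sup.mono)
    also have "\<dots> \<le> sup (d *\<^sub>R e) (sup (inf ?b ?a) (inf (- ?b) ?a))"
      by (rule sup.mono[OF order_refl riesz_inf_sup_le])
    also have "\<dots> \<le> ?w"
    proof (intro le_supI)
      show "d *\<^sub>R e \<le> ?w" by simp
      show "inf ?b ?a \<le> ?w" by (meson inf.cobounded1 le_supI2)
      have "inf (- ?b) ?a \<le> (1/2) *\<^sub>R (- ?b + ?a)" by (rule riesz_inf_le_mean)
      also have "- ?b + ?a = d *\<^sub>R e"
        by (simp add: s_def algebra_simps)
      also have "(1/2) *\<^sub>R (d *\<^sub>R e) \<le> d *\<^sub>R e"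
        using scaleR_right_mono[of "d/2" d e] e d by simp
      finally show "inf (- ?b) ?a \<le> ?w" by (meson le_supI1)
    qed
    finally show ?case .
  qed
  obtain k where k: "2 * r < real k * d" using reals_Archimedean3[OF d] by blast
  have "f \<le> r *\<^sub>R e" using f by (meson abs_ge_self order_trans)
  also have "r *\<^sub>R e \<le> s k *\<^sub>R e" using k e by (intro scaleR_right_mono) (auto simp: s_def)
  finally have "f - s k *\<^sub>R e \<le> 0" by simp
  also have "0 \<le> d *\<^sub>R e" using e d by (simp add: scaleR_nonneg_nonneg)
  finally have "sup (d *\<^sub>R e) (f - s k *\<^sub>R e) = d *\<^sub>R e" by (simp add: sup_absorb1)
  then show ?thesis using *[of k] by simp
qed

lemma vanish_if_vanish_at_unit:
  fixes U :: "'a::dedekind_complete_riesz_space \<Rightarrow> 'a"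
  assumes e: "0 \<le> e" and fI: "f \<in> principal_ideal e"
    and U: "\<And>t. U (f - t *\<^sub>R e) = U f"
    and b: "\<And>t. \<bar>U (f - t *\<^sub>R e)\<bar> \<le> C *\<^sub>R \<bar>f - t *\<^sub>R e\<bar>"
  shows "U f = 0"
proof -
  define D where "D = max C 1"
  have D: "D > 0" by (simp add: D_def)
  from fI obtain r where r: "\<bar>f\<bar> \<le> r *\<^sub>R e" by (auto simp: principal_ideal_def)
  have z: "(1/D) *\<^sub>R \<bar>U f\<bar> \<le> \<bar>f - t *\<^sub>R e\<bar>" for t
  proof -
    have "\<bar>U f\<bar> \<le> C *\<^sub>R \<bar>f - t *\<^sub>R e\<bar>" using b[of t] U[of t] by simp
    also have "\<dots> \<le> D *\<^sub>R \<bar>f - t *\<^sub>R e\<bar>" by (intro scaleR_right_mono) (auto simp: D_def)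
    finally have "(1/D) *\<^sub>R \<bar>U f\<bar> \<le> (1/D) *\<^sub>R (D *\<^sub>R \<bar>f - t *\<^sub>R e\<bar>)"
      using D by (intro scaleR_left_mono) auto
    then show ?thesis using D by simp
  qed
  have "real n *\<^sub>R ((1/D) *\<^sub>R \<bar>U f\<bar>) \<le> e" for n
  proof (cases "n = 0")
    case False
    have "(1/D) *\<^sub>R \<bar>U f\<bar> \<le> (1 / real n) *\<^sub>R e"
      using abs_diff_grid[OF e r z, of "1 / real n"] False by simp
    then have "real n *\<^sub>R ((1/D) *\<^sub>R \<bar>U f\<bar>) \<le> real n *\<^sub>R ((1 / real n) *\<^sub>R e)"
      by (intro scaleR_left_mono) auto
    then show ?thesis using False by simp
  qed (use e in simp)
  then have "(1/D) *\<^sub>R \<bar>U f\<bar> \<le> 0" by (rule riesz_archimedean)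
  then have "D *\<^sub>R ((1/D) *\<^sub>R \<bar>U f\<bar>) \<le> D *\<^sub>R 0" using D by (intro scaleR_left_mono) auto
  then have "\<bar>U f\<bar> \<le> 0" using D by simp
  then show ?thesis by simp
qed

text \<open>The square of \<open>f\<close> is the supremum of \<open>2tf - t\<^sup>2e\<close> over real \<open>t\<close>; the product is obtained by
  polarization.\<close>

definition sq_e :: "'a::dedekind_complete_riesz_space \<Rightarrow> 'a \<Rightarrow> 'a" where
  "sq_e e f = (SUP t::real. (2 * t) *\<^sub>R f - (t\<^sup>2) *\<^sub>R e)"

definition prod_e :: "'a::dedekind_complete_riesz_space \<Rightarrow> 'a \<Rightarrow> 'a \<Rightarrow> 'a" where
  "prod_e e f g = (1/4) *\<^sub>R (sq_e e (f + g) - sq_e e (f - g))"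

lemma riesz_abs_scaleR_le:
  fixes f :: "'a::dedekind_complete_riesz_space"
  shows "\<bar>c *\<^sub>R f\<bar> \<le> \<bar>c\<bar> *\<^sub>R \<bar>f\<bar>"
proof (cases "0 \<le> c")
  case True
  have "c *\<^sub>R f \<le> c *\<^sub>R \<bar>f\<bar>" "c *\<^sub>R (- f) \<le> c *\<^sub>R \<bar>f\<bar>"
    using True by (intro scaleR_left_mono; auto simp: abs_ge_self abs_ge_minus_self)+
  then show ?thesis using True by (auto intro!: abs_leI)
next
  case False
  have "(- c) *\<^sub>R f \<le> (- c) *\<^sub>R \<bar>f\<bar>" "(- c) *\<^sub>R (- f) \<le> (- c) *\<^sub>R \<bar>f\<bar>"
    using False by (intro scaleR_left_mono; auto simp: abs_ge_self abs_ge_minus_self)+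
  then show ?thesis using False by (auto intro!: abs_leI)
qed

context
  fixes e :: "'a::dedekind_complete_riesz_space"
  assumes e: "0 \<le> e"
begin

lemma idealE:
  assumes "f \<in> principal_ideal e" obtains r where "1 \<le> r" "\<bar>f\<bar> \<le> r *\<^sub>R e"
proof -
  from assms obtain r where "\<bar>f\<bar> \<le> r *\<^sub>R e" by (auto simp: principal_ideal_def)
  also have "\<dots> \<le> max r 1 *\<^sub>R e" using e by (intro scaleR_right_mono) auto
  finally show ?thesis by (intro that[of "max r 1"]) auto
qed

lemma ideal_add: assumes "f \<in> principal_ideal e" "g \<in> principal_ideal e" shows "f + g \<in> principal_ideal e"
proof -
  from assms obtain r s where "\<bar>f\<bar> \<le> r *\<^sub>R e" "\<bar>g\<bar> \<le> s *\<^sub>R e" by (auto simp: principal_ideal_def)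
  then have "\<bar>f\<bar> + \<bar>g\<bar> \<le> (r + s) *\<^sub>R e" by (simp add: scaleR_left_distrib add_mono)
  then have "\<bar>f + g\<bar> \<le> (r + s) *\<^sub>R e" by (rule order_trans[OF abs_triangle_ineq])
  then show ?thesis by (auto simp: principal_ideal_def)
qed

lemma ideal_scaleR: assumes "f \<in> principal_ideal e" shows "c *\<^sub>R f \<in> principal_ideal e"
proof -
  from assms obtain r where "\<bar>f\<bar> \<le> r *\<^sub>R e" by (auto simp: principal_ideal_def)
  then have "\<bar>c\<bar> *\<^sub>R \<bar>f\<bar> \<le> \<bar>c\<bar> *\<^sub>R (r *\<^sub>R e)" by (intro scaleR_left_mono) auto
  then have "\<bar>c *\<^sub>R f\<bar> \<le> (\<bar>c\<bar> * r) *\<^sub>R e" using riesz_abs_scaleR_le[of c f] by (auto intro: order_trans)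
  then show ?thesis by (auto simp: principal_ideal_def)
qed

lemma ideal_uminus: "f \<in> principal_ideal e \<Longrightarrow> - f \<in> principal_ideal e"
  by (simp add: principal_ideal_def)

lemma ideal_diff: "f \<in> principal_ideal e \<Longrightarrow> g \<in> principal_ideal e \<Longrightarrow> f - g \<in> principal_ideal e"
  using ideal_add[of f "- g"] ideal_uminus[of g] by simp

lemma ideal_unit: "e \<in> principal_ideal e"
  using e by (auto simp: principal_ideal_def intro!: exI[of _ 1])

lemma ideal_solid: "g \<in> principal_ideal e \<Longrightarrow> \<bar>f\<bar> \<le> \<bar>g\<bar> \<Longrightarrow> f \<in> principal_ideal e"
  unfolding principal_ideal_def by (auto intro: order_trans)

lemma ideal_pprt: "f \<in> principal_ideal e \<Longrightarrow> pprt f \<in> principal_ideal e"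
  using nprt_le_zero[of f] by (elim ideal_solid) (simp add: abs_prts[of f] abs_of_nonneg)

lemma ideal_nprt: "f \<in> principal_ideal e \<Longrightarrow> - nprt f \<in> principal_ideal e"
  using zero_le_pprt[of f] by (elim ideal_solid) (simp add: abs_prts[of f] abs_of_nonpos)

lemmas ideal_intros = ideal_add ideal_scaleR ideal_uminus ideal_diff ideal_unit

lemma sq_e_bdd:
  assumes "f \<in> principal_ideal e"
  shows "bdd_above (range (\<lambda>t::real. (2 * t) *\<^sub>R f - (t\<^sup>2) *\<^sub>R e))"
proof -
  obtain r where r: "1 \<le> r" "\<bar>f\<bar> \<le> r *\<^sub>R e" using idealE[OF assms] .
  have "(2 * t) *\<^sub>R f - (t\<^sup>2) *\<^sub>R e \<le> (r\<^sup>2) *\<^sub>R e" for t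
  proof -
    have "(2 * t) *\<^sub>R f \<le> \<bar>2 * t\<bar> *\<^sub>R \<bar>f\<bar>" by (meson abs_ge_self riesz_abs_scaleR_le order_trans)
    also have "\<dots> \<le> \<bar>2 * t\<bar> *\<^sub>R (r *\<^sub>R e)" using r by (intro scaleR_left_mono) auto
    also have "\<dots> = (2 * \<bar>t\<bar> * r) *\<^sub>R e" by (simp add: abs_mult)
    also have "\<dots> \<le> (r\<^sup>2 + t\<^sup>2) *\<^sub>R e"
      using e zero_le_power2[of "\<bar>t\<bar> - r"]
      by (intro scaleR_right_mono) (auto simp: power2_eq_square algebra_simps)
    finally show ?thesis by (simp add: algebra_simps)
  qed
  then show ?thesis by (auto simp: bdd_above_def)
qed

lemma sq_e_upper: "f \<in> principal_ideal e \<Longrightarrow> (2 * t) *\<^sub>R f - (t\<^sup>2) *\<^sub>R e \<le> sq_e e f"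
  unfolding sq_e_def by (rule cSUP_upper[OF _ sq_e_bdd]) auto

lemma sq_e_least: "(\<And>t. (2 * t) *\<^sub>R f - (t\<^sup>2) *\<^sub>R e \<le> z) \<Longrightarrow> sq_e e f \<le> z"
  unfolding sq_e_def by (rule cSUP_least) auto

lemma sq_e_minus: assumes "f \<in> principal_ideal e" shows "sq_e e (- f) = sq_e e f"
proof -
  have *: "sq_e e (- f) \<le> sq_e e f" if "f \<in> principal_ideal e" for f
  proof (rule sq_e_least)
    fix t show "(2 * t) *\<^sub>R (- f) - (t\<^sup>2) *\<^sub>R e \<le> sq_e e f"
      using sq_e_upper[OF that, of "- t"] by simp
  qed
  show ?thesis using *[OF assms] *[OF ideal_uminus[OF assms]] by (simp add: order_antisym)
qed

lemma sq_e_parallel: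
  assumes f: "f \<in> principal_ideal e" and g: "g \<in> principal_ideal e"
  shows "sq_e e (f + g) + sq_e e (f - g) = 2 *\<^sub>R sq_e e f + 2 *\<^sub>R sq_e e g"
proof (rule order_antisym)
  have key: "((2 * s) *\<^sub>R (f + g) - (s\<^sup>2) *\<^sub>R e) + ((2 * t) *\<^sub>R (f - g) - (t\<^sup>2) *\<^sub>R e) =
    2 *\<^sub>R ((2 * a) *\<^sub>R f - (a\<^sup>2) *\<^sub>R e) + 2 *\<^sub>R ((2 * b) *\<^sub>R g - (b\<^sup>2) *\<^sub>R e)"
    if "s = a + b" "t = a - b" for s t a b
  proof -
    have "((2 * s) *\<^sub>R (f + g) - (s\<^sup>2) *\<^sub>R e) + ((2 * t) *\<^sub>R (f - g) - (t\<^sup>2) *\<^sub>R e) =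
      (2 * (s + t)) *\<^sub>R f + (2 * (s - t)) *\<^sub>R g - (s\<^sup>2 + t\<^sup>2) *\<^sub>R e"
      by (simp add: algebra_simps)
    also have "2 * (s + t) = 4 * a" using that by simp
    also have "2 * (s - t) = 4 * b" using that by simp
    also have "s\<^sup>2 + t\<^sup>2 = 2 * a\<^sup>2 + 2 * b\<^sup>2" unfolding that by (simp add: power2_eq_square algebra_simps)
    also have "(4 * a) *\<^sub>R f + (4 * b) *\<^sub>R g - (2 * a\<^sup>2 + 2 * b\<^sup>2) *\<^sub>R e =
      2 *\<^sub>R ((2 * a) *\<^sub>R f - (a\<^sup>2) *\<^sub>R e) + 2 *\<^sub>R ((2 * b) *\<^sub>R g - (b\<^sup>2) *\<^sub>R e)"
      by (simp add: algebra_simps)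
    finally show ?thesis .
  qed
  let ?R = "2 *\<^sub>R sq_e e f + 2 *\<^sub>R sq_e e g" and ?L = "sq_e e (f + g) + sq_e e (f - g)"
  have 1: "((2 * s) *\<^sub>R (f + g) - (s\<^sup>2) *\<^sub>R e) + ((2 * t) *\<^sub>R (f - g) - (t\<^sup>2) *\<^sub>R e) \<le> ?R" for s t
  proof -
    have "s = (s + t) / 2 + (s - t) / 2" "t = (s + t) / 2 - (s - t) / 2"
      by (simp_all add: field_simps)
    from key[OF this] show ?thesis
      by (simp only:) (intro add_mono scaleR_left_mono sq_e_upper f g; simp)
  qed
  have "sq_e e (f + g) \<le> ?R - ((2 * t) *\<^sub>R (f - g) - (t\<^sup>2) *\<^sub>R e)" for t
    by (rule sq_e_least) (use 1 in \<open>simp add: le_diff_eq\<close>)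
  then have "sq_e e (f - g) \<le> ?R - sq_e e (f + g)"
    by (intro sq_e_least) (simp add: le_diff_eq add.commute)
  then show "?L \<le> ?R" by (simp add: le_diff_eq add.commute)
  have 2: "2 *\<^sub>R ((2 * a) *\<^sub>R f - (a\<^sup>2) *\<^sub>R e) + 2 *\<^sub>R ((2 * b) *\<^sub>R g - (b\<^sup>2) *\<^sub>R e) \<le> ?L" for a b
    by (subst key[OF refl refl, symmetric]) (intro add_mono sq_e_upper ideal_intros f g)
  have half: "x \<le> (1/2) *\<^sub>R y" if "2 *\<^sub>R x \<le> y" for x y :: 'a
    using scaleR_left_mono[OF that, of "1/2"] by simp
  have "sq_e e f \<le> (1/2) *\<^sub>R (?L - 2 *\<^sub>R ((2 * b) *\<^sub>R g - (b\<^sup>2) *\<^sub>R e))" for b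
    by (intro sq_e_least half) (use 2 in \<open>simp add: le_diff_eq\<close>)
  then have "2 *\<^sub>R sq_e e f \<le> 2 *\<^sub>R ((1/2) *\<^sub>R (?L - 2 *\<^sub>R ((2 * b) *\<^sub>R g - (b\<^sup>2) *\<^sub>R e)))" for b
    by (intro scaleR_left_mono) auto
  then have "2 *\<^sub>R sq_e e f \<le> ?L - 2 *\<^sub>R ((2 * b) *\<^sub>R g - (b\<^sup>2) *\<^sub>R e)" for b
    by simp
  then have "sq_e e g \<le> (1/2) *\<^sub>R (?L - 2 *\<^sub>R sq_e e f)"
    by (intro sq_e_least half) (simp add: le_diff_eq add.commute)
  then have "2 *\<^sub>R sq_e e g \<le> 2 *\<^sub>R ((1/2) *\<^sub>R (?L - 2 *\<^sub>R sq_e e f))"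
    by (intro scaleR_left_mono) auto
  then have "2 *\<^sub>R sq_e e g \<le> ?L - 2 *\<^sub>R sq_e e f" by simp
  then show "?R \<le> ?L" by (simp add: le_diff_eq add.commute)
qed

lemma sq_e_zero: "sq_e e 0 = 0"
proof -
  have "0 \<in> principal_ideal e" using ideal_scaleR[OF ideal_unit, of 0] by simp
  then show ?thesis using sq_e_parallel[of 0 0] by (simp add: flip: scaleR_2)
qed

lemma prod_e_comm: "f \<in> principal_ideal e \<Longrightarrow> g \<in> principal_ideal e \<Longrightarrow> prod_e e f g = prod_e e g f"
  using sq_e_minus[OF ideal_diff[of f g]] by (simp add: prod_e_def add.commute)

lemma prod_e_add_aux:
  assumes f: "f \<in> principal_ideal e" and h: "h \<in> principal_ideal e" and g: "g \<in> principal_ideal e"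
  shows "prod_e e (f + h) g + prod_e e (f - h) g = 2 *\<^sub>R prod_e e f g"
proof -
  have A: "sq_e e ((f + g) + h) + sq_e e ((f + g) - h) = 2 *\<^sub>R sq_e e (f + g) + 2 *\<^sub>R sq_e e h"
    and B: "sq_e e ((f - g) + h) + sq_e e ((f - g) - h) = 2 *\<^sub>R sq_e e (f - g) + 2 *\<^sub>R sq_e e h"
    by (intro sq_e_parallel ideal_intros f g h)+
  have "prod_e e (f + h) g + prod_e e (f - h) g =
    (1/4) *\<^sub>R ((sq_e e ((f + g) + h) + sq_e e ((f + g) - h)) - (sq_e e ((f - g) + h) + sq_e e ((f - g) - h)))"
    unfolding prod_e_def by (simp add: algebra_simps)
  also have "\<dots> = 2 *\<^sub>R prod_e e f g"
    unfolding A B prod_e_def by (simp add: algebra_simps)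
  finally show ?thesis .
qed

lemma prod_e_add:
  assumes f: "f \<in> principal_ideal e" and h: "h \<in> principal_ideal e" and g: "g \<in> principal_ideal e"
  shows "prod_e e (f + h) g = prod_e e f g + prod_e e h g"
proof -
  have z: "prod_e e 0 g = 0" using sq_e_minus[OF g] by (simp add: prod_e_def)
  have d: "prod_e e (2 *\<^sub>R x) g = 2 *\<^sub>R prod_e e x g" if "x \<in> principal_ideal e" for x
    using prod_e_add_aux[OF that that g] z by (simp add: scaleR_2)
  let ?a = "(1/2) *\<^sub>R (f + h)" and ?b = "(1/2) *\<^sub>R (f - h)"
  have a: "?a \<in> principal_ideal e" and b: "?b \<in> principal_ideal e" by (intro ideal_intros f h)+
  then have "prod_e e (?a + ?b) g + prod_e e (?a - ?b) g = prod_e e (2 *\<^sub>R ?a) g"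
    using prod_e_add_aux[OF a b g] d[OF a] by (simp only:)
  moreover have "2 *\<^sub>R ?a = f + h" by simp
  moreover have "?a + ?b = f"
    by (simp add: algebra_simps flip: scaleR_add_left)
  moreover have "?a - ?b = h"
    by (simp add: algebra_simps flip: scaleR_add_left)
  ultimately show ?thesis by (simp only:)
qed

lemma prod_e_unit: assumes f: "f \<in> principal_ideal e" shows "prod_e e f e = f"
proof -
  have fp: "f + e \<in> principal_ideal e" and fm: "f - e \<in> principal_ideal e" by (intro ideal_intros f)+
  have le: "sq_e e (g + s *\<^sub>R e) \<le> sq_e e g + ((2 * s) *\<^sub>R g + (s\<^sup>2) *\<^sub>R e)" if g: "g \<in> principal_ideal e" for s g
  proof (rule sq_e_least)
    fix t :: real
    have "(2 * t) *\<^sub>R (g + s *\<^sub>R e) - t\<^sup>2 *\<^sub>R e =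
      ((2 * (t - s)) *\<^sub>R g - ((t - s)\<^sup>2) *\<^sub>R e) + ((2 * s) *\<^sub>R g + (s\<^sup>2) *\<^sub>R e)"
      by (simp add: power2_eq_square algebra_simps flip: scaleR_add_left)
    also have "\<dots> \<le> sq_e e g + ((2 * s) *\<^sub>R g + (s\<^sup>2) *\<^sub>R e)"
      by (intro add_right_mono sq_e_upper g)
    finally show "(2 * t) *\<^sub>R (g + s *\<^sub>R e) - t\<^sup>2 *\<^sub>R e \<le> \<dots>" .
  qed
  have p: "sq_e e (f + e) = sq_e e f + (2 *\<^sub>R f + e)"
  proof (rule order_antisym)
    show "sq_e e (f + e) \<le> sq_e e f + (2 *\<^sub>R f + e)" using le[OF f, of 1] by simp
    have "sq_e e f \<le> sq_e e (f + e) + (- 2 *\<^sub>R (f + e) + e)" using le[OF fp, of "-1"] by simp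
    also have "\<dots> = sq_e e (f + e) - (2 *\<^sub>R f + e)" by (simp add: algebra_simps scaleR_2)
    finally show "sq_e e f + (2 *\<^sub>R f + e) \<le> sq_e e (f + e)" by (simp only: le_diff_eq)
  qed
  have m: "sq_e e (f - e) = sq_e e f - (2 *\<^sub>R f - e)"
  proof (rule order_antisym)
    have "sq_e e (f - e) \<le> sq_e e f + (- 2 *\<^sub>R f + e)" using le[OF f, of "-1"] by simp
    also have "\<dots> = sq_e e f - (2 *\<^sub>R f - e)" by simp
    finally show "sq_e e (f - e) \<le> \<dots>" .
    have "sq_e e f \<le> sq_e e (f - e) + (2 *\<^sub>R (f - e) + e)" using le[OF fm, of "1"] by simp
    also have "\<dots> = sq_e e (f - e) + (2 *\<^sub>R f - e)" by (simp add: algebra_simps scaleR_2)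
    finally show "sq_e e f - (2 *\<^sub>R f - e) \<le> sq_e e (f - e)" by (simp only: diff_le_eq)
  qed
  have "sq_e e (f + e) - sq_e e (f - e) = 4 *\<^sub>R f"
    unfolding p m by (simp add: algebra_simps flip: scaleR_add_left)
  then show ?thesis by (simp add: prod_e_def)
qed

lemma prod_e_nonneg:
  assumes f: "f \<in> principal_ideal e" and g: "g \<in> principal_ideal e" and "0 \<le> f" "0 \<le> g"
  shows "0 \<le> prod_e e f g"
proof -
  have "sq_e e (f - g) \<le> sq_e e (f + g)"
  proof (rule sq_e_least)
    fix t :: real
    have "(2 * t) *\<^sub>R (f - g) \<le> \<bar>2 * t\<bar> *\<^sub>R \<bar>f - g\<bar>"
      by (meson abs_ge_self riesz_abs_scaleR_le order_trans)
    also have "\<bar>f - g\<bar> \<le> f + g" using abs_triangle_ineq4[of f g] assms by simp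
    then have "\<bar>2 * t\<bar> *\<^sub>R \<bar>f - g\<bar> \<le> \<bar>2 * t\<bar> *\<^sub>R (f + g)" by (intro scaleR_left_mono) auto
    finally have "(2 * t) *\<^sub>R (f - g) - t\<^sup>2 *\<^sub>R e \<le> (2 * \<bar>t\<bar>) *\<^sub>R (f + g) - (\<bar>t\<bar>\<^sup>2) *\<^sub>R e"
      by (simp add: abs_mult)
    also have "\<dots> \<le> sq_e e (f + g)" by (intro sq_e_upper ideal_intros f g)
    finally show "(2 * t) *\<^sub>R (f - g) - t\<^sup>2 *\<^sub>R e \<le> sq_e e (f + g)" .
  qed
  then show ?thesis by (simp add: prod_e_def scaleR_nonneg_nonneg)
qed

lemma prod_e_minus: assumes f: "f \<in> principal_ideal e" and g: "g \<in> principal_ideal e" shows "prod_e e (- f) g = - prod_e e f g"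
proof -
  have "prod_e e (f + - f) g = prod_e e f g + prod_e e (- f) g"
    by (intro prod_e_add ideal_intros f g)
  moreover have "prod_e e 0 g = 0" using sq_e_minus[OF g] by (simp add: prod_e_def)
  ultimately show ?thesis by (simp add: eq_neg_iff_add_eq_0 add.commute)
qed

lemma prod_e_diff:
  assumes f: "f \<in> principal_ideal e" and h: "h \<in> principal_ideal e" and g: "g \<in> principal_ideal e"
  shows "prod_e e (f - h) g = prod_e e f g - prod_e e h g"
  using prod_e_add[OF f ideal_uminus[OF h] g] prod_e_minus[OF h g] by simp

lemma prod_e_nat: assumes f: "f \<in> principal_ideal e" and g: "g \<in> principal_ideal e"
  shows "prod_e e (real n *\<^sub>R f) g = real n *\<^sub>R prod_e e f g"
proof (induction n)
  case 0 show ?case using sq_e_minus[OF g] by (simp add: prod_e_def)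
next
  case (Suc n)
  have "prod_e e (real n *\<^sub>R f + f) g = prod_e e (real n *\<^sub>R f) g + prod_e e f g"
    by (intro prod_e_add ideal_intros f g)
  then show ?case using Suc by (simp add: algebra_simps)
qed

lemma prod_e_mono:
  assumes f: "f \<in> principal_ideal e" and h: "h \<in> principal_ideal e" and g: "g \<in> principal_ideal e" and "f \<le> h" "0 \<le> g"
  shows "prod_e e f g \<le> prod_e e h g"
  using prod_e_nonneg[OF ideal_diff[OF h f] g] prod_e_diff[OF h f g] assms by simp

lemma prod_e_scaleR_pos:
  assumes f: "f \<in> principal_ideal e" and g: "g \<in> principal_ideal e" and c: "0 \<le> c" and "0 \<le> f" "0 \<le> g"
  shows "prod_e e (c *\<^sub>R f) g = c *\<^sub>R prod_e e f g"
proof -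
  let ?P = "prod_e e f g" and ?Q = "prod_e e (c *\<^sub>R f) g"
  have P: "0 \<le> ?P" using prod_e_nonneg assms by simp
  have *: "real n *\<^sub>R ?Q \<le> real n *\<^sub>R (c *\<^sub>R ?P) + ?P \<and> real n *\<^sub>R (c *\<^sub>R ?P) \<le> real n *\<^sub>R ?Q + ?P" for n
  proof -
    define k where "k = nat \<lfloor>real n * c\<rfloor>"
    have k: "real k \<le> real n * c" "real n * c \<le> real (Suc k)"
      using c unfolding k_def by (auto simp: of_nat_nat) linarith
    have n: "real n *\<^sub>R ?Q = prod_e e ((real n * c) *\<^sub>R f) g"
      using prod_e_nat[OF ideal_scaleR[OF f] g, of n c] by simp
    have "real k *\<^sub>R ?P = prod_e e (real k *\<^sub>R f) g" by (rule prod_e_nat[OF f g, symmetric])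
    also have "\<dots> \<le> real n *\<^sub>R ?Q" unfolding n
      using assms k by (intro prod_e_mono ideal_intros f g scaleR_right_mono) auto
    finally have 1: "real k *\<^sub>R ?P \<le> real n *\<^sub>R ?Q" .
    have "real n *\<^sub>R ?Q \<le> prod_e e (real (Suc k) *\<^sub>R f) g" unfolding n
      using assms k by (intro prod_e_mono ideal_intros f g scaleR_right_mono) auto
    also have "\<dots> = real (Suc k) *\<^sub>R ?P" by (rule prod_e_nat[OF f g])
    finally have 2: "real n *\<^sub>R ?Q \<le> real (Suc k) *\<^sub>R ?P" .
    have 3: "real k *\<^sub>R ?P \<le> (real n * c) *\<^sub>R ?P" "(real n * c) *\<^sub>R ?P \<le> real (Suc k) *\<^sub>R ?P"
      using k P by (intro scaleR_right_mono; simp)+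
    have 4: "real (Suc k) *\<^sub>R ?P = real k *\<^sub>R ?P + ?P" by (simp add: algebra_simps)
    show ?thesis using 1 2 3 unfolding 4
      by (auto intro: order_trans add_right_mono)
  qed
  have "?Q - c *\<^sub>R ?P \<le> 0"
    by (rule riesz_archimedean[of _ ?P]) (use * in \<open>simp add: scaleR_diff_right diff_le_eq add.commute\<close>)
  moreover have "c *\<^sub>R ?P - ?Q \<le> 0"
    by (rule riesz_archimedean[of _ ?P]) (use * in \<open>simp add: scaleR_diff_right diff_le_eq add.commute\<close>)
  ultimately show ?thesis by (simp add: order_antisym)
qed

lemma pprt_split: "f = pprt f - (- nprt f)" for f :: 'a
  using prts[of f] by simp

lemma prod_e_scaleR:
  assumes f: "f \<in> principal_ideal e" and g: "g \<in> principal_ideal e"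
  shows "prod_e e (c *\<^sub>R f) g = c *\<^sub>R prod_e e f g"
proof -
  have 1: "prod_e e (c *\<^sub>R f) g = c *\<^sub>R prod_e e f g"
    if f: "f \<in> principal_ideal e" and g: "g \<in> principal_ideal e" and c: "0 \<le> c" and g0: "0 \<le> g" for c f g
  proof -
    define a b where "a = pprt f" and "b = - nprt f"
    have ab: "a \<in> principal_ideal e" "b \<in> principal_ideal e" "0 \<le> a" "0 \<le> b" "f = a - b"
      using ideal_pprt[OF f] ideal_nprt[OF f] pprt_split[of f] by (auto simp: a_def b_def)
    have "prod_e e (c *\<^sub>R f) g = prod_e e (c *\<^sub>R a - c *\<^sub>R b) g"
      by (simp add: ab(5) scaleR_diff_right)
    also have "\<dots> = prod_e e (c *\<^sub>R a) g - prod_e e (c *\<^sub>R b) g"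
      by (intro prod_e_diff ideal_intros ab g)
    also have "\<dots> = c *\<^sub>R (prod_e e a g - prod_e e b g)"
      by (simp add: prod_e_scaleR_pos ab c g g0 scaleR_diff_right)
    also have "\<dots> = c *\<^sub>R prod_e e f g" using prod_e_diff[OF ab(1,2) g] ab(5) by simp
    finally show ?thesis .
  qed
  have 2: "prod_e e (c *\<^sub>R f) g = c *\<^sub>R prod_e e f g"
    if f: "f \<in> principal_ideal e" and g: "g \<in> principal_ideal e" and c: "0 \<le> c" for c f g
  proof -
    define a b where "a = pprt g" and "b = - nprt g"
    have ab: "a \<in> principal_ideal e" "b \<in> principal_ideal e" "0 \<le> a" "0 \<le> b" "g = a - b"
      using ideal_pprt[OF g] ideal_nprt[OF g] pprt_split[of g] by (auto simp: a_def b_def)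
    have *: "prod_e e x g = prod_e e x a - prod_e e x b" if x: "x \<in> principal_ideal e" for x
      using prod_e_diff[OF ab(1,2) x] prod_e_comm[OF x g] prod_e_comm[OF x ab(1)] prod_e_comm[OF x ab(2)] ab(5)
      by simp
    show ?thesis
      unfolding *[OF f] *[OF ideal_scaleR[OF f]]
      by (simp add: 1 f ab(1-4) c scaleR_diff_right)
  qed
  show ?thesis
  proof (cases "0 \<le> c")
    case True then show ?thesis using 2 f g by simp
  next
    case False
    have "prod_e e (c *\<^sub>R f) g = prod_e e (- ((- c) *\<^sub>R f)) g" by simp
    also have "\<dots> = - prod_e e ((- c) *\<^sub>R f) g" by (intro prod_e_minus ideal_intros f g)
    also have "\<dots> = - ((- c) *\<^sub>R prod_e e f g)" using False 2[OF f g, of "- c"] by simp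
    finally show ?thesis by simp
  qed
qed

lemma prod_e_bound:
  assumes f: "f \<in> principal_ideal e" and h: "h \<in> principal_ideal e" and r: "\<bar>h\<bar> \<le> r *\<^sub>R e"
  shows "\<bar>prod_e e h f\<bar> \<le> r *\<^sub>R \<bar>f\<bar>"
proof -
  have h1: "h \<le> r *\<^sub>R e" "- h \<le> r *\<^sub>R e" using r by (auto intro: order_trans[OF abs_ge_self] order_trans[OF abs_ge_minus_self])
  have e1: "prod_e e (r *\<^sub>R e) x = r *\<^sub>R x" if "x \<in> principal_ideal e" for x
    using that by (simp add: prod_e_scaleR ideal_unit prod_e_comm[of e] prod_e_unit)
  have *: "\<bar>prod_e e h x\<bar> \<le> r *\<^sub>R x" if x: "x \<in> principal_ideal e" "0 \<le> x" for x
  proof -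
    have "prod_e e h x \<le> r *\<^sub>R x"
      unfolding e1[OF x(1), symmetric] by (intro prod_e_mono ideal_intros h x h1)
    moreover have "- prod_e e h x \<le> r *\<^sub>R x"
      unfolding e1[OF x(1), symmetric] prod_e_minus[OF h x(1), symmetric]
      by (intro prod_e_mono ideal_intros h x h1)
    ultimately show ?thesis by (rule abs_leI)
  qed
  define a b where "a = pprt f" and "b = - nprt f"
  have ab: "a \<in> principal_ideal e" "b \<in> principal_ideal e" "0 \<le> a" "0 \<le> b" "f = a - b"
    using ideal_pprt[OF f] ideal_nprt[OF f] pprt_split[of f] by (auto simp: a_def b_def)
  have "prod_e e h f = prod_e e h a - prod_e e h b"
    using prod_e_diff[OF ab(1,2) h] prod_e_comm[OF h f] prod_e_comm[OF h ab(1)] prod_e_comm[OF h ab(2)] ab(5)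
    by simp
  also have "\<bar>\<dots>\<bar> \<le> \<bar>prod_e e h a\<bar> + \<bar>prod_e e h b\<bar>" by (rule abs_triangle_ineq4)
  also have "\<dots> \<le> r *\<^sub>R a + r *\<^sub>R b" by (intro add_mono * ab)
  also have "\<dots> = r *\<^sub>R \<bar>f\<bar>" by (simp add: a_def b_def abs_prts scaleR_diff_right)
  finally show ?thesis .
qed

lemma prod_e_ideal: assumes f: "f \<in> principal_ideal e" and g: "g \<in> principal_ideal e" shows "prod_e e f g \<in> principal_ideal e"
proof -
  obtain r where r: "\<bar>f\<bar> \<le> r *\<^sub>R e" using idealE[OF f] .
  obtain s where s: "1 \<le> s" "\<bar>g\<bar> \<le> s *\<^sub>R e" using idealE[OF g] .
  have "\<bar>prod_e e f g\<bar> \<le> r *\<^sub>R \<bar>g\<bar>" by (rule prod_e_bound[OF g f r])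
  then have "\<bar>prod_e e f g\<bar> \<le> \<bar>r *\<^sub>R g\<bar> \<or> \<bar>prod_e e f g\<bar> \<le> r *\<^sub>R \<bar>g\<bar>" by simp
  have "r *\<^sub>R \<bar>g\<bar> \<le> \<bar>r\<bar> *\<^sub>R \<bar>g\<bar>" by (intro scaleR_right_mono) auto
  also have "\<dots> \<le> \<bar>r\<bar> *\<^sub>R (s *\<^sub>R e)" using s by (intro scaleR_left_mono) auto
  finally show ?thesis using prod_e_bound[OF g f r]
    by (auto simp: principal_ideal_def intro: order_trans)
qed

lemma prod_e_disjoint:
  assumes f: "f \<in> principal_ideal e" and g: "g \<in> principal_ideal e" and h: "h \<in> principal_ideal e" and d: "inf f g = 0" and h0: "0 \<le> h"
  shows "inf (prod_e e h f) g = 0"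
proof -
  have fg: "0 \<le> f" "0 \<le> g" using d by (metis inf.cobounded1, metis inf.cobounded2)
  obtain r where r: "1 \<le> r" "\<bar>h\<bar> \<le> r *\<^sub>R e" using idealE[OF h] .
  have "prod_e e h f \<le> r *\<^sub>R f"
    using prod_e_bound[OF f h r(2)] fg by (simp add: order_trans[OF abs_ge_self])
  then have "inf (prod_e e h f) g \<le> inf (r *\<^sub>R f) (r *\<^sub>R g)"
    using r fg scaleR_right_mono[of 1 r g] by (intro inf_mono) auto
  also have "\<dots> \<le> r *\<^sub>R inf f g"
  proof -
    have "(1/r) *\<^sub>R inf (r *\<^sub>R f) (r *\<^sub>R g) \<le> (1/r) *\<^sub>R (r *\<^sub>R f)"
      "(1/r) *\<^sub>R inf (r *\<^sub>R f) (r *\<^sub>R g) \<le> (1/r) *\<^sub>R (r *\<^sub>R g)"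
      using r by (intro scaleR_left_mono; simp)+
    then have "(1/r) *\<^sub>R inf (r *\<^sub>R f) (r *\<^sub>R g) \<le> inf f g" using r by simp
    then have "r *\<^sub>R ((1/r) *\<^sub>R inf (r *\<^sub>R f) (r *\<^sub>R g)) \<le> r *\<^sub>R inf f g"
      using r by (intro scaleR_left_mono) auto
    then show ?thesis using r by simp
  qed
  also have "\<dots> = 0" using d by simp
  finally have "inf (prod_e e h f) g \<le> 0" .
  moreover have "0 \<le> inf (prod_e e h f) g"
    using fg prod_e_nonneg[OF h f h0] by simp
  ultimately show ?thesis by (rule order_antisym)
qed

lemma prod_e_assoc:
  assumes f: "f \<in> principal_ideal e" and g: "g \<in> principal_ideal e" and h: "h \<in> principal_ideal e"
  shows "prod_e e (prod_e e f g) h = prod_e e f (prod_e e g h)"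
proof -
  define U where "U x = prod_e e (prod_e e f g) x - prod_e e f (prod_e e g x)" for x
  obtain r where r: "1 \<le> r" "\<bar>f\<bar> \<le> r *\<^sub>R e" using idealE[OF f] .
  obtain s where s: "1 \<le> s" "\<bar>g\<bar> \<le> s *\<^sub>R e" using idealE[OF g] .
  have fg: "\<bar>prod_e e f g\<bar> \<le> (r * s) *\<^sub>R e"
    using prod_e_bound[OF g f r(2)] scaleR_left_mono[OF s(2), of r] r(1) by (auto intro: order_trans)
  have bound: "\<bar>U x\<bar> \<le> (2 * (r * s)) *\<^sub>R \<bar>x\<bar>" if x: "x \<in> principal_ideal e" for x
  proof -
    have "\<bar>prod_e e f (prod_e e g x)\<bar> \<le> r *\<^sub>R \<bar>prod_e e g x\<bar>"
      by (intro prod_e_bound prod_e_ideal f g x r)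
    also have "\<dots> \<le> r *\<^sub>R (s *\<^sub>R \<bar>x\<bar>)"
      using r(1) by (intro scaleR_left_mono prod_e_bound g x s) auto
    finally have 1: "\<bar>prod_e e f (prod_e e g x)\<bar> \<le> (r * s) *\<^sub>R \<bar>x\<bar>" by simp
    have 2: "\<bar>prod_e e (prod_e e f g) x\<bar> \<le> (r * s) *\<^sub>R \<bar>x\<bar>"
      by (intro prod_e_bound prod_e_ideal f g x fg)
    have "\<bar>U x\<bar> \<le> (r * s) *\<^sub>R \<bar>x\<bar> + (r * s) *\<^sub>R \<bar>x\<bar>"
      unfolding U_def by (rule order_trans[OF abs_triangle_ineq4 add_mono[OF 2 1]])
    then show ?thesis by (simp flip: scaleR_add_left)
  qed
  have right_diff: "prod_e e k (x - t *\<^sub>R y) = prod_e e k x - t *\<^sub>R prod_e e k y"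
    if k: "k \<in> principal_ideal e" and x: "x \<in> principal_ideal e" and y: "y \<in> principal_ideal e" for k x y t
    using prod_e_diff[OF x ideal_scaleR[OF y] k, of t] prod_e_scaleR[OF y k, of t]
    by (simp add: prod_e_comm[OF k] ideal_intros x y)
  have "U (h - t *\<^sub>R e) = U h" for t
    by (simp add: U_def right_diff prod_e_ideal f g h ideal_unit prod_e_unit)
  moreover have "\<bar>U (h - t *\<^sub>R e)\<bar> \<le> (2 * (r * s)) *\<^sub>R \<bar>h - t *\<^sub>R e\<bar>" for t
    by (intro bound ideal_intros h)
  ultimately have "U h = 0" by (intro vanish_if_vanish_at_unit[OF e h])
  then show ?thesis by (simp add: U_def)
qed

lemma f_algebra_product_exists: "\<exists>m. f_algebra_product e m"
proof
  show "f_algebra_product e (prod_e e)"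
    unfolding f_algebra_product_def Let_def
  proof (intro conjI ballI allI impI; (elim conjE)?)
    fix f g h assume *: "f \<in> principal_ideal e" "g \<in> principal_ideal e" "h \<in> principal_ideal e"
    show "prod_e e h (f + g) = prod_e e h f + prod_e e h g"
      using prod_e_add[OF *] by (simp add: prod_e_comm[OF *(3)] ideal_intros *)
    show "inf (prod_e e h f) g = 0" if "inf f g = 0" "0 \<le> h" using prod_e_disjoint * that by simp
    then show "inf (prod_e e f h) g = 0" if "inf f g = 0" "0 \<le> h" using prod_e_comm * that by simp
  next
    fix c f g assume *: "f \<in> principal_ideal e" "g \<in> principal_ideal e"
    show "prod_e e f (c *\<^sub>R g) = c *\<^sub>R prod_e e f g"
      using prod_e_scaleR[OF *(2,1)] by (simp add: prod_e_comm[OF *(1)] ideal_intros *)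
  qed (simp_all add: prod_e_ideal prod_e_assoc prod_e_add prod_e_scaleR prod_e_nonneg prod_e_unit prod_e_comm[of e] ideal_unit)
qed

end

end

theory Submission
  imports Defs
begin

text \<open>The main step is that an invariant \<open>v \<ge> 0\<close> is fixed by \<open>T\<close> when all invariant components
  are. Let \<open>p\<^sub>k\<close> be the component of \<open>e\<close> in the band generated by \<open>(v - k e)\<^sup>+\<close>; it is invariant.
  The layers of \<open>v\<close> satisfy \<open>p\<^sub>k\<^sub>+\<^sub>1 \<le> (v - k e)\<^sup>+ \<sqinter> e \<le> p\<^sub>k\<close>, so that
  \<open>p\<^sub>1 + \<dots> + p\<^sub>K \<le> v \<sqinter> K e \<le> p\<^sub>1 + \<dots> + p\<^sub>K + e\<close>, and hence \<open>T v\<close> and \<open>v\<close> differ by at most \<open>e\<close>.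
  Applying this to all multiples \<open>n v\<close> gives \<open>T v = v\<close>, since the space is Archimedean.
  Invariance is always obtained from \<open>S q \<le> q\<close>, because \<open>T (q - S q) = 0\<close> and \<open>T\<close> is strictly
  positive.\<close>

section \<open>Riesz spaces\<close>

text \<open>Expanding the sum on the right gives an infimum of four sums, each of which dominates
  \<open>inf c (a + b)\<close>.\<close>

lemma inf_add_le_add_inf:
  fixes a b c :: "'a::dedekind_complete_riesz_space"
  assumes "0 \<le> a" "0 \<le> b" "0 \<le> c"
  shows "inf c (a + b) \<le> inf c a + inf c b"
proof -
  have "inf c (a + b) \<le> c" "inf c (a + b) \<le> a + b" by auto
  moreover have "c \<le> c + c" "c \<le> c + b" "c \<le> a + c" using assms by auto
  ultimately have "inf c (a + b) \<le> inf (inf (c + c) (a + c)) (inf (c + b) (a + b))"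
    by (meson le_inf_iff order_trans)
  then show ?thesis
    by (simp add: add_inf_distrib_left add_inf_distrib_right)
qed

lemma inf_eq_0_mono:
  fixes x y z :: "'a::dedekind_complete_riesz_space"
  assumes "0 \<le> x" "0 \<le> z" "x \<le> y" "inf y z = 0"
  shows "inf x z = 0"
  using assms inf_mono[OF assms(3) order_refl, of z] by (simp add: order_antisym)

lemma inf_scaleR_nat_eq_0:
  fixes x y :: "'a::dedekind_complete_riesz_space"
  assumes "inf y x = 0"
  shows "inf y (real n *\<^sub>R x) = 0"
proof -
  have xy: "0 \<le> x" "0 \<le> y" using assms by (metis inf.cobounded2, metis inf.cobounded1)
  show ?thesis
  proof (induction n)
    case 0
    then show ?case using xy by (simp add: inf_absorb2)
  next
    case (Suc n)
    have nx: "0 \<le> real n *\<^sub>R x" using xy by (simp add: scaleR_nonneg_nonneg)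
    have "inf y (real n *\<^sub>R x + x) \<le> 0"
      using inf_add_le_add_inf[OF nx xy(1) xy(2)] Suc assms by simp
    moreover have "0 \<le> inf y (real n *\<^sub>R x + x)" using nx xy by simp
    ultimately have "inf y (real n *\<^sub>R x + x) = 0" by (rule order_antisym)
    then show ?case by (simp add: scaleR_left_distrib add.commute)
  qed
qed

text \<open>This peels one layer off a truncation: with \<open>x = v - k e\<close> and
  \<open>d = e\<close> it compares the truncations of \<open>v\<close> at heights \<open>k e\<close>
  and \<open>(k + 1) e\<close>.\<close>

lemma inf_split_at_0:
  fixes x d :: "'a::dedekind_complete_riesz_space"
  assumes "0 \<le> d"
  shows "inf x d = inf x 0 + inf (sup x 0) d"
proof -
  have "inf x 0 + inf (sup x 0) d = inf (inf x 0 + sup x 0) (inf x 0 + d)"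
    by (simp add: add_inf_distrib_left)
  also have "inf x 0 + sup x 0 = x"
    using add_eq_inf_sup[of x 0] by (simp add: add.commute)
  also have "inf x (inf x 0 + d) = inf (inf x (x + d)) d"
    by (simp add: add_inf_distrib_right inf_assoc)
  also have "inf x (x + d) = x" using assms by (simp add: inf_absorb1)
  finally show ?thesis by simp
qed

lemma neg_part_eq_pos_part_diff:
  fixes u :: "'a::dedekind_complete_riesz_space"
  shows "sup (- u) 0 = sup u 0 - u"
proof -
  have "sup (- u) 0 + u = sup u 0" by (simp add: add_sup_distrib_right sup_commute)
  then show ?thesis by (simp only: eq_diff_eq)
qed

lemma component_bounds:
  assumes "component e p"
  shows "0 \<le> p" "p \<le> e"
  using assms unfolding component_def
  by (metis inf.cobounded1, metis diff_ge_0_iff_ge inf.cobounded2)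

lemma component_compl: "component e p \<Longrightarrow> component e (e - p)"
  by (simp add: component_def inf_commute)

text \<open>The excess \<open>z\<close> of \<open>v\<close> over \<open>y\<close> still fits below
  \<open>v\<close> when added to any truncation \<open>inf v (n e)\<close>. Adding
  \<open>w = inf z e\<close> repeatedly therefore never leaves \<open>v\<close>, since
  \<open>n w\<close> lies below both \<open>v\<close> and \<open>n e\<close>. The Archimedean
  property gives \<open>w = 0\<close>, and the weak unit then forces \<open>z = 0\<close>.\<close>

lemma le_SUP_inf_scaleR_unit:
  fixes v e :: "'a::dedekind_complete_riesz_space"
  assumes "weak_order_unit e" "0 \<le> v" and y: "\<And>n::nat. inf v (real n *\<^sub>R e) \<le> y"
  shows "v \<le> y"
proof -
  have e: "0 \<le> e" using assms by (simp add: weak_order_unit_def)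
  define z where "z = sup (v - y) 0"
  have z0: "0 \<le> z" by (simp add: z_def)
  have z: "z + inf v (real n *\<^sub>R e) \<le> v" for n :: nat
    using y[of n] by (simp add: z_def add_sup_distrib_right add_left_mono diff_add_eq diff_le_eq)
  define w where "w = inf z e"
  have w: "w \<le> z" "w \<le> e" by (auto simp: w_def)
  have "real n *\<^sub>R w \<le> v" for n :: nat
  proof (induction n)
    case 0
    then show ?case using assms by simp
  next
    case (Suc n)
    have "real n *\<^sub>R w \<le> real n *\<^sub>R e" using w by (intro scaleR_left_mono) auto
    then have "w + real n *\<^sub>R w \<le> z + inf v (real n *\<^sub>R e)" using Suc w by (intro add_mono) auto
    also have "\<dots> \<le> v" by (rule z)
    finally show ?case by (simp add: scaleR_left_distrib)
  qed
  then have "w \<le> 0" by (rule riesz_archimedean)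
  moreover have "0 \<le> w" using e z0 by (simp add: w_def)
  ultimately have "inf \<bar>z\<bar> e = 0" using z0 by (simp add: w_def order_antisym)
  then have "z = 0" using assms by (simp add: weak_order_unit_def)
  then show ?thesis by (metis diff_le_0_iff_le sup.cobounded1 z_def)
qed

text \<open>Order continuity is formulated for sets directed down to 0, so it is applied to the
  differences \<open>s - a n\<close> from the supremum \<open>s\<close>. Their images have infimum 0
  and all lie above \<open>L s - y\<close>.\<close>

lemma order_continuous_SUP_le:
  fixes L :: "'a::dedekind_complete_riesz_space \<Rightarrow> 'a" and a :: "nat \<Rightarrow> 'a"
  assumes L: "linear L" "order_continuous L" and a: "incseq a" "bdd_above (range a)"
    and y: "\<And>n. L (a n) \<le> y"
  shows "L (SUP n. a n) \<le> y"
proof -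
  define s where "s = (SUP n. a n)"
  have s: "a n \<le> s" for n unfolding s_def by (rule cSUP_upper[OF _ a(2)]) simp
  let ?A = "range (\<lambda>n. s - a n)"
  have "\<exists>k. a i \<le> a k \<and> a j \<le> a k" for i j
    using a(1) by (meson incseq_def max.cobounded1 max.cobounded2)
  then have dir: "directed_down ?A" by (auto simp: directed_down_def)
  have bdd: "bdd_below ?A" using s by (auto simp: bdd_below_def intro!: exI[of _ 0])
  have "Inf ?A \<le> 0"
  proof -
    have "Inf ?A \<le> s - a n" for n by (rule cINF_lower[OF bdd]) simp
    then have "a n \<le> s - Inf ?A" for n by (simp add: le_diff_eq add.commute)
    then have "s \<le> s - Inf ?A" unfolding s_def by (intro cSUP_least) auto
    then show ?thesis by simp
  qed
  moreover have "0 \<le> Inf ?A" using s by (intro cINF_greatest) auto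
  ultimately have "Inf (L ` ?A) = 0"
    using L(2) dir bdd unfolding order_continuous_def by (meson order_antisym)
  moreover have "L s - y \<le> Inf (L ` ?A)"
    using y by (intro cInf_greatest) (auto simp: linear_diff[OF L(1)] diff_left_mono)
  ultimately show ?thesis by (simp add: s_def)
qed

section \<open>The band component of the unit\<close>

text \<open>For \<open>0 \<le> x\<close> and \<open>0 \<le> e\<close> this is the projection of
  \<open>e\<close> onto the band generated by \<open>x\<close>. Writing it as the supremum of a
  sequence lets order continuity act on it directly.\<close>

definition band_component :: "'a::dedekind_complete_riesz_space \<Rightarrow> 'a \<Rightarrow> 'a" where
  "band_component e x = (SUP n::nat. inf (real n *\<^sub>R x) e)"

lemma bdd_above_inf_unit: "bdd_above (range (\<lambda>n::nat. inf (real n *\<^sub>R x) e))"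
  for e :: "'a::dedekind_complete_riesz_space"
  by (auto simp: bdd_above_def intro!: exI[of _ e])

lemma band_component_upper: "inf (real n *\<^sub>R x) e \<le> band_component e x"
  unfolding band_component_def by (rule cSUP_upper[OF _ bdd_above_inf_unit]) simp

lemma band_component_least:
  "(\<And>n::nat. inf (real n *\<^sub>R x) e \<le> y) \<Longrightarrow> band_component e x \<le> y"
  unfolding band_component_def by (intro cSUP_least) auto

lemma inf_le_band_component: "inf x e \<le> band_component e x"
  using band_component_upper[of 1] by simp

lemma band_component_le: "band_component e x \<le> e"
  by (rule band_component_least) simp

text \<open>One absorption argument is used twice: if adding \<open>y\<close> to every term
  \<open>inf (n x) e\<close> stays below \<open>?P\<close>, then \<open>?P \<le> ?P - y\<close>, so
  \<open>y \<le> 0\<close>. The first use shows that \<open>x\<close> has nothing in common with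
  \<open>e - ?P\<close>. Hence \<open>?w\<close> is disjoint from all multiples of \<open>x\<close>,
  so its sum with a term is their supremum, which lies below \<open>?P\<close>; this permits the
  second use.\<close>

lemma component_band_component:
  fixes e :: "'a::dedekind_complete_riesz_space"
  assumes "0 \<le> e" "0 \<le> x"
  shows "component e (band_component e x)"
proof -
  let ?P = "band_component e x"
  let ?w = "inf ?P (e - ?P)"
  have P0: "0 \<le> ?P" using band_component_upper[of 0 x e] assms by (simp add: inf_absorb1)
  have w0: "0 \<le> ?w" using P0 band_component_le[of e x] by simp
  define y where "y = inf x (e - ?P)"
  have y: "y \<le> x" "y \<le> e - ?P" by (auto simp: y_def)
  have "inf (real n *\<^sub>R x) e \<le> ?P - y" for n :: nat
  proof -
    have "inf (real n *\<^sub>R x) e + y \<le> real (Suc n) *\<^sub>R x"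
      using add_mono[OF inf.cobounded1[of "real n *\<^sub>R x" e] y(1)]
      by (simp add: scaleR_left_distrib add.commute)
    moreover have "inf (real n *\<^sub>R x) e + y \<le> e"
      using add_mono[OF band_component_upper[of n x e] y(2)] by simp
    ultimately have "inf (real n *\<^sub>R x) e + y \<le> inf (real (Suc n) *\<^sub>R x) e" by simp
    also have "\<dots> \<le> ?P" by (rule band_component_upper)
    finally show ?thesis by (simp add: le_diff_eq)
  qed
  then have "?P \<le> ?P - y" by (rule band_component_least)
  then have "y \<le> 0" by simp
  moreover have "inf ?w x \<le> y" by (simp add: y_def le_infI1)
  ultimately have wx: "inf ?w x = 0" using w0 assms by (meson le_inf_iff order_antisym order_trans)
  have "inf (real n *\<^sub>R x) e \<le> ?P - ?w" for n :: nat
  proof -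
    let ?a = "inf (real n *\<^sub>R x) e"
    have "inf ?a ?w \<le> inf ?w (real n *\<^sub>R x)"
      by (meson inf.cobounded1 inf.cobounded2 le_inf_iff order_trans)
    then have "inf ?a ?w \<le> 0" using inf_scaleR_nat_eq_0[OF wx] by simp
    moreover have "sup ?a ?w \<le> ?P" using band_component_upper by (simp add: le_infI1)
    ultimately have "?a + ?w \<le> ?P"
      using add_eq_inf_sup[of ?a ?w] add_mono[of "sup ?a ?w" ?P "inf ?a ?w" 0] by simp
    then show ?thesis by (simp only: le_diff_eq)
  qed
  then have "?P \<le> ?P - ?w" by (rule band_component_least)
  then have "?w \<le> 0" by (simp only: le_diff_eq add_le_same_cancel1)
  with w0 show ?thesis unfolding component_def by (rule order_antisym[rotated])
qed

text \<open>With \<open>u\<^sup>- = sup (- u) 0\<close> one has \<open>e \<le> (u + e)\<^sup>+ + u\<^sup>-\<close>, and \<open>u\<^sup>-\<close> is disjoint from \<open>n u\<^sup>+\<close>.\<close>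

lemma band_component_shift_le:
  fixes e u :: "'a::dedekind_complete_riesz_space"
  shows "band_component e (sup u 0) \<le> sup (u + e) 0"
proof (rule band_component_least)
  fix n :: nat
  let ?x = "real n *\<^sub>R sup u 0" and ?r = "sup (u + e) 0" and ?s = "sup (- u) 0"
  have x0: "0 \<le> ?x" by (simp add: scaleR_nonneg_nonneg)
  have "inf (sup u 0) ?s = 0"
  proof -
    have "inf (sup u 0) ?s = inf (sup u 0 + 0) (sup u 0 + - u)"
      by (simp only: neg_part_eq_pos_part_diff add_0_right diff_conv_add_uminus)
    also have "\<dots> = sup u 0 + inf 0 (- u)" by (simp only: add_inf_distrib_left)
    also have "inf 0 (- u) = - sup 0 u" by (simp only: neg_sup_eq_inf minus_zero)
    finally show ?thesis by (simp only: sup_commute[of 0 u] add.right_inverse)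
  qed
  then have d: "inf ?x ?s = 0"
    using inf_scaleR_nat_eq_0[of ?s "sup u 0" n] by (simp add: inf_commute)
  have "(u + e) + - u \<le> ?r + ?s" by (intro add_mono) auto
  then have "inf ?x e \<le> inf ?x (?r + ?s)" by (intro inf_mono) auto
  also have "\<dots> \<le> inf ?x ?r + inf ?x ?s" by (rule inf_add_le_add_inf) (use x0 in auto)
  also have "\<dots> \<le> ?r" using d by simp
  finally show "inf ?x e \<le> ?r" .
qed

text \<open>The truncation at height \<open>n e\<close> is the sum of the layers
  \<open>inf (w k) e\<close> for \<open>k < n\<close>. Layer \<open>k\<close> lies between
  \<open>p (Suc k)\<close> and \<open>p k\<close>, and the two resulting sums differ by
  \<open>p 0 - p n \<le> e\<close>.\<close>

lemma truncation_between_component_sums: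
  fixes e v :: "'a::dedekind_complete_riesz_space"
  assumes e: "0 \<le> e" and v: "0 \<le> v"
  defines "p \<equiv> \<lambda>k::nat. band_component e (sup (v - real k *\<^sub>R e) 0)"
  shows "(\<Sum>k<n. p (Suc k)) \<le> inf v (real n *\<^sub>R e)"
    and "inf v (real n *\<^sub>R e) \<le> (\<Sum>k<n. p (Suc k)) + e"
proof -
  define w where "w k = sup (v - real k *\<^sub>R e) 0" for k :: nat
  have step: "inf v (real (Suc k) *\<^sub>R e) = inf v (real k *\<^sub>R e) + inf (w k) e" for k
  proof -
    have "inf v (real (Suc k) *\<^sub>R e) = inf (v - real k *\<^sub>R e) e + real k *\<^sub>R e"
      by (simp add: add_inf_distrib_right scaleR_left_distrib)
    also have "\<dots> = (inf (v - real k *\<^sub>R e) 0 + real k *\<^sub>R e) + inf (w k) e"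
      using inf_split_at_0[OF e, of "v - real k *\<^sub>R e"] by (simp add: w_def)
    finally show ?thesis by (simp add: add_inf_distrib_right)
  qed
  have lower: "p (Suc k) \<le> inf (w k) e" for k
    using band_component_shift_le[of e "v - real (Suc k) *\<^sub>R e"] band_component_le
    by (simp add: p_def w_def scaleR_left_distrib)
  have upper: "inf (w k) e \<le> p k" for k
    unfolding p_def w_def by (rule inf_le_band_component)
  show "(\<Sum>k<n. p (Suc k)) \<le> inf v (real n *\<^sub>R e)"
  proof (induction n)
    case 0
    then show ?case using v by simp
  next
    case (Suc n)
    then show ?case unfolding step sum.lessThan_Suc by (intro add_mono lower)
  qed
  \<comment> \<open>The extra \<open>p n\<close> makes the induction work: it bounds the next layer,
    after which \<open>p (Suc n)\<close> is added to both sides. The start is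
    \<open>p 0 \<le> e\<close>.\<close>
  have "inf v (real n *\<^sub>R e) + p n \<le> (\<Sum>k<n. p (Suc k)) + e"
  proof (induction n)
    case 0
    then show ?case using v by (simp add: p_def band_component_le inf_absorb2)
  next
    case (Suc n)
    have "inf v (real (Suc n) *\<^sub>R e) \<le> (\<Sum>k<n. p (Suc k)) + e"
      unfolding step using add_left_mono[OF upper] Suc by (rule order_trans)
    then show ?case by (simp add: algebra_simps)
  qed
  moreover have "0 \<le> p n"
    unfolding p_def by (rule component_bounds(1), rule component_band_component[OF e]) simp
  ultimately show "inf v (real n *\<^sub>R e) \<le> (\<Sum>k<n. p (Suc k)) + e"
    by (meson add_increasing2 order_refl order_trans)
qed

section \<open>The product of components\<close>

lemma component_in_ideal:
  assumes "0 \<le> x" "x \<le> e"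
  shows "x \<in> principal_ideal e"
  using assms by (auto simp: principal_ideal_def intro!: exI[of _ 1])

text \<open>The f-algebra axiom makes \<open>m f g\<close> disjoint from \<open>f\<close>, while
  \<open>g \<le> e\<close> gives \<open>m f g \<le> m f e = f\<close>. So the product is disjoint
  from itself.\<close>

lemma f_algebra_product_disjoint:
  assumes m: "f_algebra_product e m" and f: "0 \<le> f" "f \<le> e" and g: "0 \<le> g" "g \<le> e"
    and d: "inf f g = 0"
  shows "m f g = 0"
proof -
  note I = component_in_ideal[OF f] component_in_ideal[OF g]
  have e: "0 \<le> e" using f by order
  have eI: "e \<in> principal_ideal e" and gI: "e - g \<in> principal_ideal e"
    using e g by (auto intro: component_in_ideal)
  have add: "m f (g + (e - g)) = m f g + m f (e - g)" and e1: "m f e = f"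
    and pos: "0 \<le> m f (e - g)" "0 \<le> m f g"
    using m I gI f g unfolding f_algebra_product_def Let_def by (blast, simp_all)
  have "inf (m f g) f = 0"
    using m I d f unfolding f_algebra_product_def Let_def by (metis inf_commute)
  moreover have "m f g \<le> f"
    using add e1 pos by (metis add_diff_cancel_left' diff_add_cancel diff_ge_0_iff_ge)
  ultimately show ?thesis by (simp add: inf_absorb1)
qed

text \<open>Split \<open>p\<close> as \<open>?r + (p - ?r)\<close> and \<open>e\<close> as
  \<open>q + (e - q)\<close>. Since \<open>p - ?r\<close> is disjoint from \<open>q\<close> and
  \<open>?r\<close> from \<open>e - q\<close>, both cross terms vanish and
  \<open>m p q = m ?r q = m ?r e = ?r\<close>.\<close>

lemma f_algebra_product_component:
  assumes m: "f_algebra_product e m" and p: "component e p" and q: "component e q"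
  shows "m p q = inf p q"
proof -
  note b = component_bounds[OF p] component_bounds[OF q]
  let ?r = "inf p q"
  have r: "0 \<le> ?r" "?r \<le> e" using b by (auto intro: le_infI1)
  have pr: "0 \<le> p - ?r" "p - ?r \<le> e"
    using add_mono[OF b(2) r(1)] by (simp_all only: diff_ge_0_iff_ge diff_le_eq inf.cobounded1 add_0_right)
  have eq: "0 \<le> e - q" "e - q \<le> e" using b by auto
  have "p - ?r = sup p q - q"
    by (simp only: diff_eq_eq diff_add_eq eq_diff_eq add_eq_inf_sup[symmetric])
  also have "\<dots> \<le> e - q" using b by (intro diff_right_mono) auto
  finally have "p - ?r \<le> e - q" .
  then have "inf (p - ?r) q = 0"
    by (rule inf_eq_0_mono[OF pr(1) b(3)]) (use q in \<open>simp only: component_def inf_commute\<close>)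
  then have 1: "m (p - ?r) q = 0"
    by (rule f_algebra_product_disjoint[OF m pr b(3,4)])
  have "inf ?r (e - q) = 0"
    by (rule inf_eq_0_mono[OF r(1) eq(1), of q]) (use q in \<open>simp_all only: component_def inf.cobounded2\<close>)
  then have 2: "m ?r (e - q) = 0"
    by (rule f_algebra_product_disjoint[OF m r eq])
  have I: "?r \<in> principal_ideal e" "p - ?r \<in> principal_ideal e" "q \<in> principal_ideal e"
      "e - q \<in> principal_ideal e"
    by (rule component_in_ideal[OF r], rule component_in_ideal[OF pr],
        rule component_in_ideal[OF b(3,4)], rule component_in_ideal[OF eq])
  have "m (?r + (p - ?r)) q = m ?r q + m (p - ?r) q"
    and "m ?r (q + (e - q)) = m ?r q + m ?r (e - q)" and "m ?r e = ?r"
    using m I unfolding f_algebra_product_def Let_def by blast+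
  then show ?thesis using 1 2 by (simp only: add_diff_cancel_left' diff_add_cancel add_diff_eq add_0_right)
qed

section \<open>Conditional expectation preserving systems\<close>

locale preserving_system =
  fixes T S :: "'a::dedekind_complete_riesz_space \<Rightarrow> 'a" and e :: 'a
  assumes system: "cond_exp_preserving_system T S e"
begin

lemma
  shows unit: "weak_order_unit e" and e_nonneg: "0 \<le> e"
    and T_linear: "linear T" and T_strict: "0 < f \<Longrightarrow> 0 < T f"
    and T_cont: "order_continuous T" and T_idem: "T (T f) = T f" and T_e: "T e = e"
    and S_linear: "linear S" and S_cont: "order_continuous S"
    and S_sup: "S (sup f g) = sup (S f) (S g)" and S_inf: "S (inf f g) = inf (S f) (S g)"
    and S_e: "S e = e" and T_S: "T (S f) = T f"
  using system
  unfolding cond_exp_preserving_system_def conditional_riesz_triple_def weak_order_unit_def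
    conditional_expectation_def riesz_homomorphism_def strictly_positive_def
  by blast+

lemma in_range_T_iff: "f \<in> range T \<longleftrightarrow> T f = f"
  by (metis T_idem rangeE rangeI)

lemma T_nonneg: "0 \<le> f \<Longrightarrow> 0 \<le> T f"
  using T_strict[of f] linear_0[OF T_linear] by (cases "f = 0") (auto simp: less_le)

lemma T_mono: "f \<le> g \<Longrightarrow> T f \<le> T g"
  using T_nonneg[of "g - f"] by (simp add: linear_diff[OF T_linear])

lemma S_mono: "f \<le> g \<Longrightarrow> S f \<le> S g"
  by (metis S_inf inf.absorb_iff1)

lemma T_eq_0D: "0 \<le> f \<Longrightarrow> T f = 0 \<Longrightarrow> f = 0"
  using T_strict[of f] by (auto simp: less_le)

lemma subinvariant_imp_invariant:
  assumes "S q \<le> q"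
  shows "S q = q"
  using T_eq_0D[of "q - S q"] assms by (simp add: linear_diff[OF T_linear] T_S)

lemma component_S: "component e p \<Longrightarrow> component e (S p)"
  unfolding component_def by (metis S_e S_inf S_linear linear_0 linear_diff)

lemma component_S_pow: "component e p \<Longrightarrow> component e ((S ^^ n) p)"
  by (induction n) (auto intro: component_S)

text \<open>The orbit of \<open>p\<close> need not be monotone, so order continuity is applied to
  its increasing partial suprema. Applying \<open>S\<close> to one of these only shifts the
  exponents, which stay at least 1.\<close>

lemma S_SUP_orbit:
  assumes p: "component e p"
  shows "S (SUP n\<in>{1..}. (S ^^ n) p) = (SUP n\<in>{1..}. (S ^^ n) p)"
proof (rule subinvariant_imp_invariant)
  let ?q = "SUP n\<in>{1..}. (S ^^ n) p"
  have bdd: "bdd_above ((\<lambda>n. (S ^^ n) p) ` {1..})"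
    using component_bounds(2)[OF component_S_pow[OF p]] by (auto simp: bdd_above_def)
  have up: "(S ^^ n) p \<le> ?q" if "1 \<le> n" for n
    using that by (intro cSUP_upper[OF _ bdd]) auto
  \<comment> \<open>\<open>b n\<close> is the supremum of \<open>(S ^^ i) p\<close> for
    \<open>i\<close> from 1 to \<open>n + 1\<close>; the shift is due to the orbit starting at
    exponent 1.\<close>
  define b where "b = rec_nat (S p) (\<lambda>n x. sup x ((S ^^ Suc (Suc n)) p))"
  have b0: "b 0 = S p" and bS: "b (Suc n) = sup (b n) ((S ^^ Suc (Suc n)) p)" for n
    by (simp_all add: b_def)
  have inc: "incseq b" by (rule incseq_SucI) (simp add: bS)
  have bq: "b n \<le> ?q" for n
    by (induction n) (use up[of 1] up[of "Suc (Suc _)"] in \<open>auto simp: b0 bS simp del: funpow.simps(2)\<close>, simp)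
  have Sbq: "S (b n) \<le> ?q" for n
  proof (induction n)
    case 0
    then show ?case using up[of 2] by (simp add: b0 numeral_2_eq_2)
  next
    case (Suc n)
    then show ?case using up[of "Suc (Suc (Suc n))"] by (simp add: bS S_sup)
  qed
  have bddb: "bdd_above (range b)" using bq by (auto simp: bdd_above_def)
  have "(S ^^ Suc n) p \<le> b n" for n by (cases n) (simp_all add: b0 bS)
  then have "(S ^^ n) p \<le> (SUP n. b n)" if "1 \<le> n" for n
    using that by (cases n) (auto intro: order_trans[OF _ cSUP_upper[OF _ bddb]] simp del: funpow.simps(2))
  then have "?q \<le> (SUP n. b n)" by (intro cSUP_least) auto
  then have "S ?q \<le> S (SUP n. b n)" by (rule S_mono)
  also have "\<dots> \<le> ?q" by (rule order_continuous_SUP_le[OF S_linear S_cont inc bddb Sbq])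
  finally show "S ?q \<le> ?q" .
qed

text \<open>Every term \<open>inf (n x) e\<close> is fixed by \<open>S\<close>, so order continuity
  keeps the image of the supremum below the supremum.\<close>

lemma S_band_component:
  assumes "0 \<le> x" "S x = x"
  shows "S (band_component e x) = band_component e x"
proof (rule subinvariant_imp_invariant)
  have inc: "incseq (\<lambda>n::nat. inf (real n *\<^sub>R x) e)"
    using assms by (intro incseq_SucI inf_mono scaleR_right_mono) auto
  have le: "S (inf (real n *\<^sub>R x) e) \<le> band_component e x" for n
    using band_component_upper[of n x e] assms by (simp add: S_inf S_e linear_scale[OF S_linear])
  show "S (band_component e x) \<le> band_component e x"
    by (rule order_continuous_SUP_le[OF S_linear S_cont inc bdd_above_inf_unit le,
          folded band_component_def])
qed

text \<open>The point is that the error \<open>e\<close> is the same for every \<open>v\<close>, so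
  that it becomes negligible for large multiples of \<open>v\<close>.\<close>

lemma T_near_invariant:
  assumes comp: "\<And>p. component e p \<Longrightarrow> S p = p \<Longrightarrow> T p = p"
    and v: "0 \<le> v" "S v = v"
  shows "T v \<le> v + e" "v \<le> T v + e"
proof -
  let ?t = "\<lambda>n::nat. inf v (real n *\<^sub>R e)"
  define p where "p k = band_component e (sup (v - real k *\<^sub>R e) 0)" for k :: nat
  have "T (p k) = p k" for k
  proof (rule comp)
    show "component e (p k)"
      unfolding p_def by (intro component_band_component e_nonneg) simp
    show "S (p k) = p k"
      unfolding p_def
      by (rule S_band_component)
        (simp_all add: S_sup linear_diff[OF S_linear] linear_scale[OF S_linear] linear_0[OF S_linear] S_e v)
  qed
  then have fix_sum: "T (\<Sum>k<n. p (Suc k)) = (\<Sum>k<n. p (Suc k))" for n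
    by (simp add: linear_sum[OF T_linear])
  note between = truncation_between_component_sums[OF e_nonneg v(1), folded p_def]
  have lo: "(\<Sum>k<n. p (Suc k)) \<le> T (?t n)" and hi: "T (?t n) \<le> (\<Sum>k<n. p (Suc k)) + e" for n
    using T_mono[OF between(1)] T_mono[OF between(2)]
    by (simp_all add: linear_add[OF T_linear] fix_sum T_e)
  have Tt: "T (?t n) \<le> v + e" for n
    using hi[of n] between(1)[of n] by (meson add_right_mono le_inf_iff order_trans)
  have inc: "incseq ?t"
    using e_nonneg by (intro incseq_SucI inf_mono scaleR_right_mono) auto
  have bdd: "bdd_above (range ?t)" by (auto simp: bdd_above_def intro!: exI[of _ v])
  \<comment> \<open>The bound on \<open>T\<close> of the truncations passes to \<open>T v\<close>,
    because \<open>v\<close> is their supremum and \<open>T\<close> is order continuous.\<close>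
  have "v \<le> (SUP n. ?t n)"
    by (rule le_SUP_inf_scaleR_unit[OF unit v(1)], rule cSUP_upper[OF _ bdd]) simp
  then have "T v \<le> T (SUP n. ?t n)" by (rule T_mono)
  also have "\<dots> \<le> v + e" by (rule order_continuous_SUP_le[OF T_linear T_cont inc bdd Tt])
  finally show "T v \<le> v + e" .
  \<comment> \<open>Here the truncations of \<open>v\<close> themselves are bounded, through the
    sums of components and monotonicity of \<open>T\<close>.\<close>
  show "v \<le> T v + e"
  proof (rule le_SUP_inf_scaleR_unit[OF unit v(1)])
    fix n
    have "T (?t n) \<le> T v" by (rule T_mono) simp
    then show "?t n \<le> T v + e"
      using between(2)[of n] lo[of n] by (meson add_right_mono order_trans)
  qed
qed

lemma T_invariant_nonneg:
  assumes comp: "\<And>p. component e p \<Longrightarrow> S p = p \<Longrightarrow> T p = p"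
    and v: "0 \<le> v" "S v = v"
  shows "T v = v"
proof (rule order_antisym)
  have near: "real n *\<^sub>R T v \<le> real n *\<^sub>R v + e" "real n *\<^sub>R v \<le> real n *\<^sub>R T v + e" for n :: nat
    using T_near_invariant[OF comp, of "real n *\<^sub>R v"] v
    by (simp_all add: linear_scale[OF T_linear] linear_scale[OF S_linear] scaleR_nonneg_nonneg)
  have "T v - v \<le> 0"
    by (rule riesz_archimedean[of _ e]) (use near in \<open>simp add: scaleR_diff_right diff_le_eq add.commute\<close>)
  then show "T v \<le> v" by simp
  have "v - T v \<le> 0"
    by (rule riesz_archimedean[of _ e]) (use near in \<open>simp add: scaleR_diff_right diff_le_eq add.commute\<close>)
  then show "v \<le> T v" by simp
qed

text \<open>A lattice homomorphism fixes the positive and negative parts of each element that it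
  fixes, which reduces the claim to nonnegative elements.\<close>

lemma ergodic_if_invariant_components:
  assumes comp: "\<And>p. component e p \<Longrightarrow> S p = p \<Longrightarrow> T p = p"
  shows "ergodic T S"
  unfolding ergodic_def
proof (intro allI impI)
  fix f assume f: "S f = f"
  have "T (sup f 0) = sup f 0" "T (sup (- f) 0) = sup (- f) 0"
    by (rule T_invariant_nonneg[OF comp];
        simp add: S_sup f linear_0[OF S_linear] linear_neg[OF S_linear])+
  moreover have "f = sup f 0 - sup (- f) 0" by (simp add: neg_part_eq_pos_part_diff)
  ultimately show "T f = f" by (metis linear_diff[OF T_linear])
qed

end

section \<open>The three conditions linked in a cycle\<close>

theorem theorem7:
  fixes T S :: "'a::dedekind_complete_riesz_space \<Rightarrow> 'a"
    and e :: 'a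
    and m :: "'a \<Rightarrow> 'a \<Rightarrow> 'a"
  assumes "cond_exp_preserving_system T S e"
    and "f_algebra_product e m"
  shows "(ergodic T S \<longleftrightarrow>
            (\<forall>p. component e p \<longrightarrow> T (m (e - p) (S p)) = 0 \<longrightarrow> p \<in> range T))
       \<and> (ergodic T S \<longleftrightarrow>
            (\<forall>p. component e p \<longrightarrow> (SUP n\<in>{1..}. (S ^^ n) p) \<in> range T))"
    (is "(?i \<longleftrightarrow> ?ii) \<and> (?i \<longleftrightarrow> ?iii)")
proof -
  interpret preserving_system T S e using assms(1) by unfold_locales
  have prod: "m (e - p) (S p) = inf (e - p) (S p)" if "component e p" for p
    using that by (intro f_algebra_product_component[OF assms(2)] component_compl component_S)
  \<comment> \<open>The cycle runs from \<open>?i\<close> to \<open>?iii\<close> to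
    \<open>?ii\<close> and back to \<open>?i\<close>. The first implication holds because the
    supremum over the orbit is invariant.\<close>
  have "?iii" if ?i
    using that S_SUP_orbit unfolding ergodic_def in_range_T_iff by blast
  moreover have "?ii" if ?iii
  proof (intro allI impI)
    fix p assume p: "component e p" and T0: "T (m (e - p) (S p)) = 0"
    note b = component_bounds[OF p] component_bounds[OF component_S[OF p]]
    have "0 \<le> inf (e - p) (S p)" using b by simp
    \<comment> \<open>Strict positivity of \<open>T\<close> turns the vanishing expectation into
      disjointness. The sum of the disjoint elements \<open>e - p\<close> and \<open>S p\<close> is
      their supremum, hence at most \<open>e\<close>, which says \<open>S p \<le> p\<close>.\<close>
    then have "inf (e - p) (S p) = 0" using T0 prod[OF p] T_eq_0D by simp
    then have "e - p + S p = sup (e - p) (S p)" using add_eq_inf_sup[of "e - p" "S p"] by simp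
    also have "\<dots> \<le> e" using b by simp
    finally have "S p \<le> p" by (simp add: algebra_simps)
    then have Sp: "S p = p" by (rule subinvariant_imp_invariant)
    \<comment> \<open>The orbit of an invariant \<open>p\<close> is constant, so the supremum in
      \<open>?iii\<close> is \<open>p\<close> itself.\<close>
    have "(S ^^ n) p = p" for n by (induction n) (simp_all add: Sp)
    then have "(SUP n\<in>{1..}. (S ^^ n) p) = p" by simp
    then show "p \<in> range T" using that p by metis
  qed
  moreover have "?i" if ?ii
  proof (rule ergodic_if_invariant_components)
    \<comment> \<open>For an invariant component the product in \<open>?ii\<close> is
      \<open>inf (e - p) p = 0\<close>, so the premise of \<open>?ii\<close> holds.\<close>
    fix p assume p: "component e p" "S p = p"
    then have "m (e - p) (S p) = 0" using prod[OF p(1)] by (simp add: component_def inf_commute)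
    then have "T (m (e - p) (S p)) = 0" by (simp add: linear_0[OF T_linear])
    then show "T p = p" using that p in_range_T_iff by blast
  qed
  ultimately show ?thesis by blast
qed

end
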